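(* For any $x\ge0$ and $j=0,1,2,\ldots$, we have $$\sum_{n=-\infty}^\infty e^{-2x}I_n(2x)\,n^{2j}\le\frac{(4j)!}{(2j)!}\max(x^j,1).$$
   Context: $I_n$ denotes the modified Bessel function of the first kind of integer order $n$. When $j=0$, $n^{2j}=1$ for all $n$ (including $n=0$). *)

theory Defs
  imports "HOL-Analysis.Analysis"
begin

text \<open>
  The modified Bessel function of the first kind of integer order \<open>n\<close>, as its defining power series
  \<open>(x/2)^(2m+n) / (m! \<Gamma>(m+n+1))\<close> summed over \<open>m \<ge> 0\<close>. The reciprocal Gamma function vanishes at
  the non-positive integers, so for \<open>n < 0\<close> only the terms with \<open>m \<ge> - n\<close> contribute; in these the
  exponent \<open>2m+n\<close> is non-negative, so the formula is also correct at \<open>x = 0\<close>.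
\<close>

definition bessel_I :: "int \<Rightarrow> real \<Rightarrow> real" where
  "bessel_I n x =
     (\<Sum>m. (x / 2) powi (2 * int m + n) * rGamma (of_int (int m + n + 1)) / fact m)"

end

theory Submission
  imports Defs
begin

text \<open>
  The weights \<open>exp (- 2 * x) * bessel_I n (2 * x)\<close> form the Skellam distribution: they are the
  probabilities that the difference of two independent Poisson variables of mean \<open>x\<close> equals \<open>n\<close>.
  Hence they sum to \<open>1\<close>, and the theorem is a bound on the even moments of this distribution.

  The three-term relation \<open>n * I\<^sub>n(2x) = x * (I\<^bsub>n-1\<^esub>(2x) - I\<^bsub>n+1\<^esub>(2x))\<close> acts on moments as an
  integration by parts: multiplied by \<open>n ^ k\<close> and summed over all integers, it expresses the moment of
  order \<open>k + 1\<close> through the mean of \<open>(n + 1) ^ k - (n - 1) ^ k\<close>, which has degree below \<open>k\<close> in \<open>n\<close>.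
  Summability of all moments follows by induction; for odd \<open>k\<close> and the moment \<open>M\<^sub>j\<close> of order \<open>2 * j\<close>,
  one obtains the recurrence (lemma \<open>skellam_even_moment_recurrence\<close>)
  \<open>M\<^bsub>j+1\<^esub> = 2 * x * (\<Sum>i\<le>j. (2 * j + 1 choose 2 * i) * M\<^sub>i)\<close>.

  All its coefficients are nonnegative, so an upper bound for the earlier moments can be inserted.
  As each step contributes one factor \<open>x\<close>, the growth \<open>max (x ^ j) 1\<close> reproduces itself, and it remains
  to check that the constants \<open>c\<^sub>j = (4j)! / (2j)!\<close> satisfy
  \<open>2 * (\<Sum>i\<le>j. (2 * j + 1 choose 2 * i) * c\<^sub>i) \<le> c\<^bsub>j+1\<^esub>\<close> (lemma \<open>fact_quotient_recurrence_bound\<close>).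
  Written as \<open>c\<^sub>i = (4 * i choose 2 * i) * (2 * i)!\<close>, each of the \<open>j + 1\<close> summands is at most
  \<open>(2 * j + 1)!\<close> times the central binomial coefficient \<open>(4 * j + 4 choose 2 * j + 2)\<close>, and
  \<open>2 * (j + 1) * (2 * j + 1)! = (2 * j + 2)!\<close>.
\<close>

section \<open>Unordered sums\<close>

lemma has_sum_diff:
  fixes f g :: "'a \<Rightarrow> 'b :: real_normed_algebra_1"
  assumes "(f has_sum a) A" and "(g has_sum b) A"
  shows "((\<lambda>x. f x - g x) has_sum (a - b)) A"
  using has_sum_add[OF assms(1) has_sum_uminusI[OF assms(2)]] by simp

lemma has_sum_sum:
  fixes f :: "'i \<Rightarrow> 'a \<Rightarrow> 'b :: topological_comm_monoid_add"
  assumes "\<And>i. i \<in> I \<Longrightarrow> (f i has_sum s i) A"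
  shows "((\<lambda>x. \<Sum>i\<in>I. f i x) has_sum (\<Sum>i\<in>I. s i)) A"
  using assms
proof (induction I rule: infinite_finite_induct)
  case (insert i I)
  then show ?case by (simp add: has_sum_add)
qed auto

lemma has_sum_int_if_nonneg_support:
  fixes f :: "int \<Rightarrow> 'a :: {comm_monoid_add, topological_space}"
  assumes "\<And>k. k < 0 \<Longrightarrow> f k = 0"
  shows "(f has_sum s) UNIV \<longleftrightarrow> ((\<lambda>m. f (int m)) has_sum s) UNIV"
proof -
  have "(f has_sum s) UNIV \<longleftrightarrow> (f has_sum s) (range int)"
    using assms by (intro has_sum_cong_neutral) (auto simp: image_iff, metis nonneg_int_cases not_le)
  also have "\<dots> \<longleftrightarrow> ((\<lambda>m. f (int m)) has_sum s) UNIV"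
    by (subst has_sum_reindex) (auto simp: o_def)
  finally show ?thesis .
qed

section \<open>The Bessel function as an autocorrelation of exponential coefficients\<close>

text \<open>
  The coefficients of the exponential series are extended by zero to all integers, so that shifts of
  the summation index need no case distinction and no boundary terms appear.
\<close>

definition exp_coeff :: "real \<Rightarrow> int \<Rightarrow> real" where
  "exp_coeff x k = (if k < 0 then 0 else x ^ nat k / fact (nat k))"

lemma exp_coeff_nonneg: "x \<ge> 0 \<Longrightarrow> exp_coeff x k \<ge> 0"
  by (simp add: exp_coeff_def)

lemma exp_coeff_recurrence: "of_int k * exp_coeff x k = x * exp_coeff x (k - 1)"
proof (cases "k \<le> 0")
  case True
  then show ?thesis by (cases "k = 0") (auto simp: exp_coeff_def)
next
  case False
  then obtain m where "k = int (Suc m)"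
    by (metis gr0_implies_Suc nat_0_le not_le order_less_imp_le zero_less_nat_eq)
  then show ?thesis
    by (simp add: exp_coeff_def nat_add_distrib divide_simps add_eq_0_iff)
qed

lemma has_sum_exp_coeff:
  assumes "x \<ge> 0"
  shows "(exp_coeff x has_sum exp x) UNIV"
proof -
  have "(\<lambda>m. exp_coeff x (int m)) sums exp x"
    using exp_converges[of x] by (simp add: exp_coeff_def divide_inverse mult.commute)
  then have "((\<lambda>m. exp_coeff x (int m)) has_sum exp x) UNIV"
    using assms by (intro sums_nonneg_imp_has_sum) (auto intro: exp_coeff_nonneg)
  then show ?thesis
    by (subst has_sum_int_if_nonneg_support) (auto simp: exp_coeff_def)
qed

text \<open>
  Where \<open>int m + n < 0\<close>, the zero of the reciprocal Gamma function matches the zero extension of the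
  coefficients; elsewhere the exponent splits as \<open>m + (m + n)\<close>.
\<close>

lemma bessel_I_term:
  "x powi (2 * int m + n) * rGamma (of_int (int m + n + 1)) / fact m
     = exp_coeff x (int m) * exp_coeff x (int m + n)"
proof (cases "int m + n < 0")
  case True
  then show ?thesis unfolding rGamma_of_int by (simp add: exp_coeff_def)
next
  case False
  have "x powi (2 * int m + n) = x ^ m * x ^ nat (int m + n)"
  proof -
    have "nat (2 * int m + n) = m + nat (int m + n)" using False by linarith
    then show ?thesis using False by (simp add: power_int_def power_add)
  qed
  with False show ?thesis unfolding rGamma_of_int by (simp add: exp_coeff_def field_simps)
qed

text \<open>
  The change of variables \<open>(a, b) = (m, m + n)\<close> turns this double sum into the product
  \<open>exp x * exp x\<close> of two exponential series.
\<close>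

lemma has_sum_exp_coeff_pair:
  assumes "x \<ge> 0"
  shows "((\<lambda>(n, m). exp_coeff x m * exp_coeff x (m + n)) has_sum exp (2 * x)) (UNIV \<times> UNIV)"
proof -
  let ?e = "exp_coeff x"
  have sums: "(?e has_sum exp x) UNIV" by (rule has_sum_exp_coeff[OF assms])
  have row: "((\<lambda>b. ?e a * ?e b) has_sum ?e a * exp x) UNIV" for a
    using sums by (rule has_sum_cmult_right)
  have col: "((\<lambda>a. ?e a * exp x) has_sum exp x * exp x) UNIV"
    using sums by (rule has_sum_cmult_left)
  have "(\<lambda>(a, b). ?e a * ?e b) summable_on UNIV \<times> UNIV"
    using row col by (intro summable_on_SigmaI[where g = "\<lambda>a. ?e a * exp x"])
      (auto simp: exp_coeff_nonneg[OF assms] intro: has_sum_imp_summable)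
  then have "((\<lambda>(a, b). ?e a * ?e b) has_sum exp x * exp x) (UNIV \<times> UNIV)"
    using row col by (intro has_sum_SigmaI) auto
  also have "?this \<longleftrightarrow> ?thesis"
    by (rule has_sum_reindex_bij_witness
          [where i = "\<lambda>(n, m). (m, m + n)" and j = "\<lambda>(a, b). (b - a, a)"])
       (auto simp flip: exp_add)
  finally show ?thesis .
qed

lemma has_sum_bessel_I:
  assumes "x \<ge> 0"
  shows "((\<lambda>m. exp_coeff x m * exp_coeff x (m + n)) has_sum bessel_I n (2 * x)) UNIV"
proof -
  let ?f = "\<lambda>m. exp_coeff x m * exp_coeff x (m + n)"
  have "?f summable_on UNIV"
    using has_sum_imp_summable[OF has_sum_exp_coeff_pair[OF assms]]
      summable_on_SigmaD1[of "\<lambda>n m. exp_coeff x m * exp_coeff x (m + n)" UNIV "\<lambda>_. UNIV" n]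
    by (auto simp: exp_coeff_nonneg[OF assms])
  then obtain s where s: "(?f has_sum s) UNIV" by (auto simp: summable_on_def)
  then have "((\<lambda>m. ?f (int m)) has_sum s) UNIV"
    by (subst (asm) has_sum_int_if_nonneg_support) (auto simp: exp_coeff_def)
  then have "(\<lambda>m. ?f (int m)) sums s" by (rule has_sum_imp_sums)
  then have "bessel_I n (2 * x) = s"
    unfolding bessel_I_def by (simp only: bessel_I_term nonzero_mult_div_cancel_left sums_iff)
  with s show ?thesis by simp
qed

text \<open>
  In each term of the autocorrelation one writes \<open>n = (m + n) - m\<close>. Each of the two factors is
  absorbed by lowering the index of one exponential coefficient, which changes the lag by one.
\<close>

lemma bessel_I_recurrence:
  assumes "x \<ge> 0"
  shows "of_int n * bessel_I n (2 * x) = x * (bessel_I (n - 1) (2 * x) - bessel_I (n + 1) (2 * x))"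
proof -
  let ?e = "exp_coeff x"
  have split: "of_int n * (?e m * ?e (m + n))
      = x * (?e m * ?e (m + (n - 1)) - ?e (m - 1) * ?e ((m - 1) + (n + 1)))" for m
  proof -
    have "of_int n * (?e m * ?e (m + n))
        = ?e m * (of_int (m + n) * ?e (m + n)) - (of_int m * ?e m) * ?e (m + n)"
      by (simp add: algebra_simps)
    also have "\<dots> = x * (?e m * ?e (m + (n - 1)) - ?e (m - 1) * ?e ((m - 1) + (n + 1)))"
      unfolding exp_coeff_recurrence by (simp add: algebra_simps)
    finally show ?thesis .
  qed
  have "((\<lambda>m. ?e (m - 1) * ?e ((m - 1) + (n + 1))) has_sum bessel_I (n + 1) (2 * x)) UNIV"
    using has_sum_bessel_I[OF assms, of "n + 1"]
    by (subst has_sum_reindex_bij_witness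
          [where i = "\<lambda>m. m + 1" and j = "\<lambda>m. m - 1" and T = UNIV
             and h = "\<lambda>m. ?e m * ?e (m + (n + 1))"]) auto
  then have "((\<lambda>m. of_int n * (?e m * ?e (m + n))) has_sum
      x * (bessel_I (n - 1) (2 * x) - bessel_I (n + 1) (2 * x))) UNIV"
    unfolding split
    by (intro has_sum_cmult_right has_sum_diff has_sum_bessel_I[OF assms])
  moreover have "((\<lambda>m. of_int n * (?e m * ?e (m + n))) has_sum of_int n * bessel_I n (2 * x)) UNIV"
    by (intro has_sum_cmult_right has_sum_bessel_I[OF assms])
  ultimately show ?thesis by (rule has_sum_unique[rotated])
qed

section \<open>The Skellam distribution and its moments\<close>

definition skellam :: "real \<Rightarrow> int \<Rightarrow> real" where
  "skellam x n = exp (- 2 * x) * bessel_I n (2 * x)"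

text \<open>
  Summing the autocorrelation over all lags gives the square of the total mass of the coefficients.
\<close>

lemma has_sum_skellam:
  assumes "x \<ge> 0"
  shows "(skellam x has_sum 1) UNIV"
proof -
  have "((\<lambda>n. bessel_I n (2 * x)) has_sum exp (2 * x)) UNIV"
    by (rule has_sum_SigmaD[OF has_sum_exp_coeff_pair[OF assms]])
      (use has_sum_bessel_I[OF assms] in simp)
  from has_sum_cmult_right[OF this, of "exp (- 2 * x)"] show ?thesis
    by (simp add: skellam_def[abs_def] flip: exp_add)
qed

lemma skellam_recurrence:
  assumes "x \<ge> 0"
  shows "skellam x n * of_int n = x * (skellam x (n - 1) - skellam x (n + 1))"
proof -
  have "skellam x n * of_int n = exp (- 2 * x) * (of_int n * bessel_I n (2 * x))"
    by (simp add: skellam_def)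
  also have "\<dots> = x * (skellam x (n - 1) - skellam x (n + 1))"
    unfolding bessel_I_recurrence[OF assms] by (simp add: skellam_def algebra_simps)
  finally show ?thesis .
qed

definition skellam_moment :: "real \<Rightarrow> nat \<Rightarrow> real" where
  "skellam_moment x k = (\<Sum>\<^sub>\<infinity>n. skellam x n * of_int n ^ k)"

text \<open>
  Shifting the index in the recurrence moves the difference of neighbouring weights onto the powers,
  giving \<open>(n + 1) ^ k - (n - 1) ^ k\<close>; the factor \<open>1 - (- 1) ^ (k - i)\<close> is what the binomial theorem
  leaves of it. Only summability up to order \<open>k\<close> is assumed, so that the lemma also proves
  summability of the moment of order \<open>k + 1\<close>.
\<close>

lemma has_sum_skellam_moment_Suc:
  assumes "x \<ge> 0" and "\<And>i. i \<le> k \<Longrightarrow> (\<lambda>n. skellam x n * of_int n ^ i) summable_on UNIV"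
  shows "((\<lambda>n. skellam x n * of_int n ^ Suc k) has_sum
    x * (\<Sum>i\<le>k. of_nat (k choose i) * (1 - (- 1) ^ (k - i)) * skellam_moment x i)) UNIV"
proof -
  have shifted: "((\<lambda>n. skellam x n * (of_int n + c) ^ k) has_sum
      (\<Sum>i\<le>k. of_nat (k choose i) * c ^ (k - i) * skellam_moment x i)) UNIV" for c
  proof -
    have "((\<lambda>n. \<Sum>i\<le>k. (of_nat (k choose i) * c ^ (k - i)) * (skellam x n * of_int n ^ i)) has_sum
      (\<Sum>i\<le>k. of_nat (k choose i) * c ^ (k - i) * skellam_moment x i)) UNIV"
      unfolding skellam_moment_def
      by (intro has_sum_sum has_sum_cmult_right has_sum_infsum assms) auto
    then show ?thesis
      by (simp add: binomial_ring sum_distrib_left mult_ac)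
  qed
  have up: "((\<lambda>n. skellam x (n - 1) * of_int n ^ k) has_sum s) UNIV
      \<longleftrightarrow> ((\<lambda>n. skellam x n * (of_int n + 1) ^ k) has_sum s) UNIV" for s
    by (rule has_sum_reindex_bij_witness[where i = "\<lambda>n. n + 1" and j = "\<lambda>n. n - 1"]) auto
  have down: "((\<lambda>n. skellam x (n + 1) * of_int n ^ k) has_sum s) UNIV
      \<longleftrightarrow> ((\<lambda>n. skellam x n * (of_int n + (- 1)) ^ k) has_sum s) UNIV" for s
    by (rule has_sum_reindex_bij_witness[where i = "\<lambda>n. n - 1" and j = "\<lambda>n. n + 1"]) auto
  have "skellam x n * of_int n ^ Suc k
      = x * (skellam x (n - 1) * of_int n ^ k - skellam x (n + 1) * of_int n ^ k)" for n
    using skellam_recurrence[OF assms(1), of n]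
    by (simp only: power_Suc mult.assoc[symmetric]) (simp add: algebra_simps)
  then have "?thesis \<longleftrightarrow> ((\<lambda>n. x * (skellam x (n - 1) * of_int n ^ k - skellam x (n + 1) * of_int n ^ k)) has_sum
    x * (\<Sum>i\<le>k. of_nat (k choose i) * (1 - (- 1) ^ (k - i)) * skellam_moment x i)) UNIV"
    by (simp only:)
  moreover have "((\<lambda>n. x * (skellam x (n - 1) * of_int n ^ k - skellam x (n + 1) * of_int n ^ k)) has_sum
      x * ((\<Sum>i\<le>k. of_nat (k choose i) * 1 ^ (k - i) * skellam_moment x i)
         - (\<Sum>i\<le>k. of_nat (k choose i) * (- 1) ^ (k - i) * skellam_moment x i))) UNIV"
    by (intro has_sum_cmult_right has_sum_diff up[THEN iffD2] down[THEN iffD2] shifted)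
  ultimately show ?thesis
    by (simp add: sum_subtractf left_diff_distrib right_diff_distrib)
qed

lemma summable_skellam_moment:
  assumes "x \<ge> 0"
  shows "(\<lambda>n. skellam x n * of_int n ^ k) summable_on UNIV"
proof (induction k rule: less_induct)
  case (less k)
  show ?case
  proof (cases k)
    case 0
    then show ?thesis using has_sum_imp_summable[OF has_sum_skellam[OF assms]] by simp
  next
    case (Suc l)
    then show ?thesis
      using has_sum_imp_summable[OF has_sum_skellam_moment_Suc[OF assms, of l]] less by auto
  qed
qed

lemma skellam_moment_0: "x \<ge> 0 \<Longrightarrow> skellam_moment x 0 = 1"
  by (simp add: skellam_moment_def infsumI[OF has_sum_skellam])

text \<open>
  For odd \<open>k\<close> the factor \<open>1 - (- 1) ^ (k - i)\<close> is \<open>2\<close> at even \<open>i\<close> and \<open>0\<close> at odd \<open>i\<close>, so the even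
  moments satisfy a closed recurrence.
\<close>

lemma skellam_even_moment_recurrence:
  assumes "x \<ge> 0"
  shows "skellam_moment x (2 * Suc j)
    = 2 * x * (\<Sum>i\<le>j. of_nat (Suc (2 * j) choose (2 * i)) * skellam_moment x (2 * i))"
proof -
  let ?k = "Suc (2 * j)"
  let ?g = "\<lambda>i. of_nat (?k choose i) * (1 - (- 1) ^ (?k - i)) * skellam_moment x i"
  have "skellam_moment x (Suc ?k) = x * (\<Sum>i\<le>?k. ?g i)"
    unfolding skellam_moment_def[of x "Suc ?k"]
    by (intro infsumI has_sum_skellam_moment_Suc summable_skellam_moment assms)
  also have "(\<Sum>i\<le>?k. ?g i) = (\<Sum>i\<in>(\<lambda>i. 2 * i) ` {..j}. ?g i)"
  proof (rule sum.mono_neutral_right)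
    show "\<forall>i\<in>{..?k} - (\<lambda>i. 2 * i) ` {..j}. ?g i = 0"
    proof
      fix i assume i: "i \<in> {..?k} - (\<lambda>i. 2 * i) ` {..j}"
      then have "odd i" by (auto elim!: evenE)
      then show "?g i = 0" using i by simp
    qed
  qed auto
  also have "\<dots> = (\<Sum>i\<le>j. ?g (2 * i))"
    by (simp add: sum.reindex inj_on_def)
  also have "\<dots> = (\<Sum>i\<le>j. 2 * (of_nat (?k choose (2 * i)) * skellam_moment x (2 * i)))"
    by (rule sum.cong) auto
  finally show ?thesis by (simp add: sum_distrib_left mult_ac)
qed

section \<open>Bounding the even moments\<close>

lemma fact_quotient_eq: "fact (4 * i) / fact (2 * i) = (of_nat ((4 * i) choose (2 * i)) * fact (2 * i) :: real)"
  by (simp add: binomial_fact)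

lemma central_binomial_mono: "m \<le> n \<Longrightarrow> (2 * m) choose m \<le> (2 * n) choose n"
  by (meson binomial_maximum' binomial_right_mono le_trans mult_le_mono2)

text \<open>
  The moment recurrence is satisfied by the constants as an inequality. Each summand contains
  \<open>(2 * j + 1 choose 2 * i) * (2 * i)!\<close>, a divisor of \<open>(2 * j + 1)!\<close>, and twice the number of
  summands is exactly the factor that leads from \<open>(2 * j + 1)!\<close> to \<open>(2 * j + 2)!\<close>.
\<close>

lemma fact_quotient_recurrence_bound:
  "2 * (\<Sum>i\<le>j. real (Suc (2 * j) choose (2 * i)) * (fact (4 * i) / fact (2 * i)))
     \<le> fact (4 * Suc j) / fact (2 * Suc j)"
proof -
  let ?B = "real ((4 * Suc j) choose (2 * Suc j))"
  have "real (Suc (2 * j) choose (2 * i)) * (fact (4 * i) / fact (2 * i)) \<le> fact (Suc (2 * j)) * ?B"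
    if "i \<le> j" for i
  proof -
    have "(Suc (2 * j) choose (2 * i)) * fact (2 * i) \<le> (fact (Suc (2 * j)) :: nat)"
    proof (rule dvd_imp_le)
      have "fact (Suc (2 * j))
          = (Suc (2 * j) choose (2 * i)) * fact (2 * i) * (fact (Suc (2 * j) - 2 * i) :: nat)"
        using binomial_fact_lemma[of "2 * i" "Suc (2 * j)"] that by (simp only: mult_ac)
      then show "(Suc (2 * j) choose (2 * i)) * fact (2 * i) dvd (fact (Suc (2 * j)) :: nat)"
        by (rule dvdI)
    qed (rule fact_gt_zero)
    then have "real ((Suc (2 * j) choose (2 * i)) * fact (2 * i)) \<le> real (fact (Suc (2 * j)))"
      by (rule of_nat_mono)
    then have coeff: "real (Suc (2 * j) choose (2 * i)) * fact (2 * i) \<le> fact (Suc (2 * j))"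
      by (simp only: of_nat_fact of_nat_mult)
    have "real ((4 * i) choose (2 * i)) \<le> real ((4 * k) choose (2 * k))" if "i \<le> k" for k
      using central_binomial_mono[of "2 * i" "2 * k"] that by simp
    from this[of "Suc j"] have central: "real ((4 * i) choose (2 * i)) \<le> ?B"
      using \<open>i \<le> j\<close> by (simp only: le_SucI)
    have "real (Suc (2 * j) choose (2 * i)) * (fact (4 * i) / fact (2 * i))
        = real (Suc (2 * j) choose (2 * i)) * fact (2 * i) * real ((4 * i) choose (2 * i))"
      unfolding fact_quotient_eq by (simp only: mult_ac)
    also have "\<dots> \<le> fact (Suc (2 * j)) * ?B"
      by (rule mult_mono[OF coeff central]) (rule fact_ge_zero, rule of_nat_0_le_iff)
    finally show ?thesis .
  qed
  then have "2 * (\<Sum>i\<le>j. real (Suc (2 * j) choose (2 * i)) * (fact (4 * i) / fact (2 * i)))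
      \<le> 2 * (real (card {..j}) * (fact (Suc (2 * j)) * ?B))"
    by (intro mult_left_mono sum_bounded_above) auto
  also have "\<dots> = fact (2 * Suc j) * ?B"
    by (simp add: algebra_simps del: binomial_Suc_Suc)
  also have "\<dots> = fact (4 * Suc j) / fact (2 * Suc j)"
    unfolding fact_quotient_eq by (rule mult.commute)
  finally show ?thesis .
qed

lemma skellam_even_moment_bound:
  assumes "x \<ge> 0"
  shows "skellam_moment x (2 * j) \<le> fact (4 * j) / fact (2 * j) * max (x ^ j) 1"
proof (induction j rule: less_induct)
  case (less j)
  show ?case
  proof (cases j)
    case 0
    then show ?thesis by (simp add: skellam_moment_0[OF assms])
  next
    case (Suc l)
    let ?c = "\<lambda>i. fact (4 * i) / fact (2 * i) :: real"
    \<comment> \<open>The factor \<open>x\<close> raises the exponent by one when \<open>x > 1\<close> and keeps the product at most \<open>1\<close> otherwise.\<close>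
    have max_step: "x * max (x ^ i) 1 \<le> max (x ^ Suc l) 1" if "i \<le> l" for i
    proof (cases "x \<le> 1")
      case True
      then show ?thesis using assms by (simp add: max_def power_le_one)
    next
      case False
      then show ?thesis
        using that one_le_power[of x i] power_increasing[of "Suc i" "Suc l" x]
        by (simp add: max.absorb1 le_max_iff_disj)
    qed
    have step: "x * skellam_moment x (2 * i) \<le> ?c i * max (x ^ Suc l) 1" if "i \<le> l" for i
    proof -
      have "x * skellam_moment x (2 * i) \<le> x * (?c i * max (x ^ i) 1)"
        using less[of i] that Suc assms by (intro mult_left_mono) auto
      also have "\<dots> = ?c i * (x * max (x ^ i) 1)" by simp
      also have "\<dots> \<le> ?c i * max (x ^ Suc l) 1"
        by (intro mult_left_mono max_step that) auto
      finally show ?thesis .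
    qed
    have "skellam_moment x (2 * Suc l)
        = 2 * (\<Sum>i\<le>l. of_nat (Suc (2 * l) choose (2 * i)) * (x * skellam_moment x (2 * i)))"
      unfolding skellam_even_moment_recurrence[OF assms] by (simp add: sum_distrib_left mult_ac)
    also have "\<dots> \<le> 2 * (\<Sum>i\<le>l. of_nat (Suc (2 * l) choose (2 * i)) * (?c i * max (x ^ Suc l) 1))"
      by (intro mult_left_mono sum_mono step) auto
    also have "\<dots> = 2 * (\<Sum>i\<le>l. of_nat (Suc (2 * l) choose (2 * i)) * ?c i) * max (x ^ Suc l) 1"
      by (simp only: sum_distrib_right mult.assoc)
    also have "\<dots> \<le> ?c (Suc l) * max (x ^ Suc l) 1"
      by (intro mult_right_mono fact_quotient_recurrence_bound) auto
    finally show ?thesis unfolding Suc .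
  qed
qed

theorem proposition8p3:
  fixes x :: real and j :: nat
  assumes "x \<ge> 0"
  shows "(\<lambda>n::int. exp (- 2 * x) * bessel_I n (2 * x) * of_int n ^ (2 * j)) summable_on UNIV \<and>
    (\<Sum>\<^sub>\<infinity>n::int. exp (- 2 * x) * bessel_I n (2 * x) * of_int n ^ (2 * j))
      \<le> fact (4 * j) / fact (2 * j) * max (x ^ j) 1"
  using summable_skellam_moment[OF assms, of "2 * j"] skellam_even_moment_bound[OF assms, of j]
  unfolding skellam_moment_def skellam_def by blast

end
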